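(* Let $A=(a_{ij})_{i,j=1,\dots,n}$ be a real matrix with $a_{ij}\ge 0$ for all $i,j$ and with at least one zero row, and let $n_0\in\{1,\dots,n\}$ be such that all rows of $A$ with indices $n_0+1,\dots,n$ are zero rows. Let $A_{n_0}$, $A_{n_0-1}$ and $A_{in_0}$ ($1\le i\le n_0-1$) be the matrices defined in the context. Then: 1) If $\det(A_{n_0})\ne 0$, then the operator $A$ has the unique fixed point $(0,\dots,0)\in\mathcal I_n$. 2) If $\det(A_{n_0})=0$ and $\operatorname{rank}(A_{n_0})=n_0-1$, then the operator $A$ has the unique fixed point $(0,\dots,0)$ if and only if $$\det(A_{i_0n_0})\cdot\det(A_{n_0-1})>0\quad\text{for some } i_0\in\{1,\dots,n_0-1\}.\qquad( * )$$ 3) If (in the situation of 2)) condition $( * )$ is not satisfied, then the operator $A$ has infinitely many fixed points $x=x(\alpha)$ of the form $$x(\alpha)=\left(-\frac{\det(A_{1n_0})}{\det(A_{n_0-1})}\alpha,\ -\frac{\det(A_{2n_0})}{\det(A_{n_0-1})}\alpha,\ \dots,\ -\frac{\det(A_{(n_0-1)n_0})}{\det(A_{n_0-1})}\alpha,\ \alpha,\ 0,0,\dots,0\right),$$ where $\alpha\le 0$.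
   Context: $\mathbf R_{\max}=\mathbf R\cup\{-\infty\}$ and $\mathcal I_n=\{(x_1,\dots,x_n)\in\mathbf R_{\max}^n:\max_{1\le i\le n}x_i=0\}$. The matrix $A$ acts by ordinary matrix-vector multiplication, $(A(x))_i=\sum_j a_{ij}x_j$, and maps $\mathcal I_n$ to itself. Fixed points of $A$ are the solutions $x\in\mathcal I_n$ of $A(x)=x$. For $1\le k\le n_0$, $A_k=(a_{ij}-\delta_{ij})_{i,j=1,\dots,k}$ (with $\delta_{ij}$ the Kronecker delta); in particular $A_{n_0}=(a_{ij}-\delta_{ij})_{i,j=1,\dots,n_0}$. For $1\le i\le n_0-1$, $A_{in_0}$ is the $(n_0-1)\times(n_0-1)$ matrix obtained from $A_{n_0-1}$ by replacing its $i$-th column with $(a_{1n_0},a_{2n_0},\dots,a_{(n_0-1)n_0})^{T}$. Standing convention when $\det(A_{n_0})=0$ and $\operatorname{rank}(A_{n_0})=r$: the first $r$ rows of $A_{n_0}$ are assumed, without loss of generality, to be linearly independent, and the system $A_{n_0}(x)=0$, $x=(x_1,\dots,x_{n_0})$, is written by Cramer's rule with denominator $\det(A_r)$, expressing $x_1,\dots,x_r$ through $x_{r+1},\dots,x_{n_0}$. Here $r=n_0-1$.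
   Formalization: Fixed points are taken with all coordinates finite, since with −∞ allowed (0·(−∞)=0) claim 1 fails: A=diag(2,0), n_0=1 also fixes (−∞,0). In 2) and 3), det(A_{n_0-1})≠0 is assumed explicitly, as the Cramer convention requires. *)

theory Defs
  imports
    "HOL-Library.Extended_Real"
    "Jordan_Normal_Form.Determinant"
    "Jordan_Normal_Form.DL_Rank"
begin

text \<open>
  Vector and matrix indices run from 0, so the entry written with indices \<open>i, j\<close> on paper is
  \<open>A $$ (i - 1, j - 1)\<close>. The max-plus line is the set of extended reals other than \<open>\<infinity>\<close>.
\<close>

definition Rmax :: "ereal set" where
  "Rmax = {x. x \<noteq> \<infinity>}"

definition idem :: "nat \<Rightarrow> ereal vec set" where
  "idem n = {x \<in> carrier_vec n. (\<forall>i<n. x $ i \<in> Rmax) \<and> (MAX i\<in>{..<n}. x $ i) = 0}"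

text \<open>
  The library product \<open>*\<^sub>v\<close> is not available here because \<open>ereal\<close> is not a semiring. The convention
  \<open>0 * (-\<infinity>) = 0\<close> of \<open>ereal\<close> is the one under which a nonnegative matrix with a zero row maps
  \<open>idem n\<close> to itself.
\<close>

definition act :: "real mat \<Rightarrow> ereal vec \<Rightarrow> ereal vec" where
  "act A x = vec (dim_row A) (\<lambda>i. \<Sum>j<dim_col A. ereal (A $$ (i, j)) * x $ j)"

definition fixed_points :: "nat \<Rightarrow> real mat \<Rightarrow> ereal vec set" where
  "fixed_points n A = {x \<in> idem n. act A x = x}"

text \<open>
  The linear system \<open>(A - I) x = 0\<close> is equivalent to \<open>A x = x\<close> only for vectors without infinite
  coordinates, and its solutions are sought among these. See \<open>infinite_fixed_point\<close> below for a
  fixed point that the system does not see.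
\<close>

definition finite_fixed_points :: "nat \<Rightarrow> real mat \<Rightarrow> ereal vec set" where
  "finite_fixed_points n A = {x \<in> fixed_points n A. \<forall>i<n. x $ i \<noteq> -\<infinity>}"

definition shifted :: "real mat \<Rightarrow> nat \<Rightarrow> real mat" where
  "shifted A k = mat k k (\<lambda>(i, j). A $$ (i, j) - (if i = j then 1 else 0))"

text \<open>For \<open>i < n\<^sub>0 - 1\<close> this is the matrix written \<open>A\<close> with subscript \<open>(i + 1) n\<^sub>0\<close>.\<close>

definition shifted_repl :: "real mat \<Rightarrow> nat \<Rightarrow> nat \<Rightarrow> real mat" where
  "shifted_repl A n\<^sub>0 i =
     replace_col (shifted A (n\<^sub>0 - 1)) (vec (n\<^sub>0 - 1) (\<lambda>p. A $$ (p, n\<^sub>0 - 1))) i"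

definition sign_cond :: "real mat \<Rightarrow> nat \<Rightarrow> bool" where
  "sign_cond A n\<^sub>0 \<longleftrightarrow>
     (\<exists>i<n\<^sub>0 - 1. det (shifted_repl A n\<^sub>0 i) * det (shifted A (n\<^sub>0 - 1)) > 0)"

text \<open>
  Cramer's rule for \<open>(A - I) x = 0\<close> in the first \<open>n\<^sub>0\<close> unknowns, with the \<open>n\<^sub>0\<close>-th one free. It is
  meaningful when the denominator is nonzero, which implies that the first \<open>n\<^sub>0 - 1\<close> rows of
  \<open>shifted A n\<^sub>0\<close> are linearly independent; the converse implication fails, so nonvanishing of
  the denominator has to be required separately.
\<close>

definition fixed_ray :: "nat \<Rightarrow> real mat \<Rightarrow> nat \<Rightarrow> real \<Rightarrow> ereal vec" where
  "fixed_ray n A n\<^sub>0 \<alpha> = vec n (\<lambda>i.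
     if i < n\<^sub>0 - 1 then ereal (- (det (shifted_repl A n\<^sub>0 i) / det (shifted A (n\<^sub>0 - 1))) * \<alpha>)
     else if i = n\<^sub>0 - 1 then ereal \<alpha>
     else 0)"

lemma idem_iff:
  assumes "n \<ge> 1"
  shows "x \<in> idem n \<longleftrightarrow> x \<in> carrier_vec n \<and> (\<forall>i<n. x $ i \<le> 0) \<and> (\<exists>i<n. x $ i = 0)"
proof -
  have "finite ((\<lambda>i. x $ i) ` {..<n})" "(\<lambda>i. x $ i) ` {..<n} \<noteq> {}"
    using assms by (auto simp: lessThan_empty_iff)
  from Max_eq_iff[OF this, of 0] show ?thesis
    by (fastforce simp: idem_def Rmax_def)
qed

lemma act_idem:
  assumes "A \<in> carrier_mat n n" "\<And>i j. i < n \<Longrightarrow> j < n \<Longrightarrow> A $$ (i, j) \<ge> 0"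
    and "k < n" "row A k = 0\<^sub>v n" and "x \<in> idem n"
  shows "act A x \<in> idem n"
proof -
  have n: "n \<ge> 1" using assms(3) by simp
  have le: "x $ j \<le> 0" if "j < n" for j
    using assms(5) that idem_iff[OF n] by blast
  have "act A x $ i \<le> 0" if i: "i < n" for i
  proof -
    have "(\<Sum>j<n. ereal (A $$ (i, j)) * x $ j) \<le> 0"
    proof (rule sum_nonpos)
      fix j assume "j \<in> {..<n}"
      then show "ereal (A $$ (i, j)) * x $ j \<le> 0"
        using assms(2)[OF i, of j] le[of j] by (simp add: ereal_mult_le_0_iff)
    qed
    then show ?thesis using assms(1) i by (simp add: act_def)
  qed
  moreover have "A $$ (k, j) = 0" if "j < n" for j
    using assms(1,3,4) that by (metis carrier_matD index_row(1) index_zero_vec(1))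
  hence "act A x $ k = 0"
    using assms(1,3) by (simp add: act_def flip: zero_ereal_def)
  moreover have "act A x \<in> carrier_vec n"
    using assms(1) by (simp add: act_def)
  ultimately show ?thesis using assms(3) idem_iff[OF n] by blast
qed

lemma infinite_fixed_point:
  defines "A \<equiv> mat 2 2 (\<lambda>(i, j). if i = 0 \<and> j = 0 then 2 else 0 :: real)"
    and "x \<equiv> vec 2 (\<lambda>i. if i = 0 then -\<infinity> else 0 :: ereal)"
  shows "det (shifted A 1) \<noteq> 0" and "x \<in> fixed_points 2 A" and "x \<noteq> 0\<^sub>v 2"
proof -
  show "det (shifted A 1) \<noteq> 0"
    by (subst det_single) (simp_all add: shifted_def A_def)
  have "x \<in> carrier_vec 2" "\<forall>i<2. x $ i \<le> 0" "1 < (2::nat)" "x $ 1 = 0"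
    by (simp_all add: x_def)
  then have "x \<in> idem 2"
    using idem_iff[of 2 x] by (metis one_le_numeral)
  moreover have "act A x = x"
  proof (rule eq_vecI)
    fix i assume "i < dim_vec x"
    then have i: "i < 2" by (simp add: x_def)
    have "act A x $ i = ereal (A $$ (i, 0)) * x $ 0 + ereal (A $$ (i, 1)) * x $ 1"
      using i by (simp add: act_def A_def numeral_2_eq_2)
    also have "\<dots> = x $ i"
      using i by (simp add: A_def x_def zero_ereal_def[symmetric])
    finally show "act A x $ i = x $ i" .
  qed (simp add: act_def A_def x_def)
  ultimately show "x \<in> fixed_points 2 A" by (simp add: fixed_points_def)
  have "x $ 0 \<noteq> (0\<^sub>v 2 :: ereal vec) $ 0" by (simp add: x_def)
  then show "x \<noteq> 0\<^sub>v 2" by metis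
qed

end

theory Submission
  imports Defs
begin

text \<open>
  A finite fixed point vanishes beyond the first \<open>n\<^sub>0\<close> coordinates, so it amounts to a nonpositive
  vector in the kernel of \<open>shifted A n\<^sub>0\<close>; the requirement that some coordinate be 0 is automatic
  because of the zero row. When the principal minor of size \<open>n\<^sub>0 - 1\<close> is nonzero and the full
  determinant vanishes, Cramer's rule shows that the kernel is the line over the last coordinate
  \<open>\<alpha>\<close>. Such a vector is nonpositive for some \<open>\<alpha> < 0\<close> exactly when all Cramer quotients are
  nonpositive, that is, when the sign condition fails.
\<close>

lemma shifted_carrier [simp]: "shifted A k \<in> carrier_mat k k"
  by (simp add: shifted_def)

lemma dim_shifted [simp]: "dim_row (shifted A k) = k" "dim_col (shifted A k) = k"
  by (simp_all add: shifted_def)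

lemma shifted_mult_vec_index:
  assumes "y \<in> carrier_vec k" "i < k"
  shows "(shifted A k *\<^sub>v y) $ i = (\<Sum>j<k. A $$ (i, j) * y $ j) - y $ i"
proof -
  have "(shifted A k *\<^sub>v y) $ i = (\<Sum>j<k. (A $$ (i, j) - (if i = j then 1 else 0)) * y $ j)"
    using assms by (simp add: shifted_def scalar_prod_def atLeast0LessThan)
  also have "\<dots> = (\<Sum>j<k. A $$ (i, j) * y $ j - (if j = i then y $ j else 0))"
    by (rule sum.cong) (auto simp: algebra_simps)
  finally show ?thesis
    using assms by (simp add: sum_subtractf)
qed

lemma solve_det_nonzero:
  fixes B :: "'a :: field mat"
  assumes "B \<in> carrier_mat m m" "det B \<noteq> 0" "c \<in> carrier_vec m"
  obtains w where "w \<in> carrier_vec m" "B *\<^sub>v w = c"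
    "\<And>i. i < m \<Longrightarrow> w $ i = det (replace_col B c i) / det B"
proof -
  from det_non_zero_imp_unit[OF assms(1,2), of "()"] obtain C
    where C: "C \<in> carrier_mat m m" "B * C = 1\<^sub>m m"
    unfolding Units_def by (auto simp: ring_mat_def)
  have w: "C *\<^sub>v c \<in> carrier_vec m" "B *\<^sub>v (C *\<^sub>v c) = c"
    using assms C by (auto simp flip: assoc_mult_mat_vec)
  show ?thesis
  proof (rule that[OF w])
    fix i assume "i < m"
    from cramer_lemma_mat[OF assms(1) w(1) this]
    show "(C *\<^sub>v c) $ i = det (replace_col B c i) / det B"
      using assms(2) w(2) by (simp add: field_simps)
  qed
qed

lemma kernel_shifted_Suc_imp:
  assumes "det (shifted A m) \<noteq> 0"
    and y: "y \<in> carrier_vec (Suc m)" and "shifted A (Suc m) *\<^sub>v y = 0\<^sub>v (Suc m)" and "i < m"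
  shows "y $ i = - (det (shifted_repl A (Suc m) i) / det (shifted A m)) * y $ m"
proof -
  define c where "c = vec m (\<lambda>p. A $$ (p, m))"
  obtain w where w: "w \<in> carrier_vec m" "shifted A m *\<^sub>v w = c"
    and w_eq: "\<And>i. i < m \<Longrightarrow> w $ i = det (replace_col (shifted A m) c i) / det (shifted A m)"
    using solve_det_nonzero[OF shifted_carrier assms(1), of c] by (auto simp: c_def)
  define z where "z = vec m (($) y) + y $ m \<cdot>\<^sub>v w"
  have z: "z \<in> carrier_vec m"
    using w by (simp add: z_def)
  have "shifted A m *\<^sub>v z = 0\<^sub>v m"
  proof (rule eq_vecI)
    fix p assume "p < dim_vec (0\<^sub>v m :: real vec)"
    then have p: "p < m" by simp
    have "(shifted A m *\<^sub>v z) $ p = (shifted A m *\<^sub>v vec m (($) y)) $ p + y $ m * c $ p"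
      using w p c_def unfolding z_def
      by (simp add: mult_add_distrib_mat_vec[where nr = m and nc = m]
          mult_mat_vec[where nr = m and nc = m])
    also have "\<dots> = (shifted A (Suc m) *\<^sub>v y) $ p"
      using p y by (simp add: shifted_mult_vec_index c_def del: index_mult_mat_vec)
    finally show "(shifted A m *\<^sub>v z) $ p = 0\<^sub>v m $ p"
      using assms(3) p by simp
  qed (simp add: shifted_def)
  then have "z = 0\<^sub>v m"
    using det_0_iff_vec_prod_zero[OF shifted_carrier, of A m] assms(1) z by blast
  then have "z $ i = 0"
    using \<open>i < m\<close> by simp
  then have "y $ i + y $ m * w $ i = 0"
    using \<open>i < m\<close> w(1) by (simp add: z_def)
  then show ?thesis
    using w_eq[OF \<open>i < m\<close>] by (simp add: shifted_repl_def c_def algebra_simps)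
qed

lemma kernel_shifted_Suc_iff:
  assumes "det (shifted A m) \<noteq> 0" "det (shifted A (Suc m)) = 0"
    and y: "y \<in> carrier_vec (Suc m)"
  shows "shifted A (Suc m) *\<^sub>v y = 0\<^sub>v (Suc m) \<longleftrightarrow>
    (\<forall>i<m. y $ i = - (det (shifted_repl A (Suc m) i) / det (shifted A m)) * y $ m)"
    (is "_ \<longleftrightarrow> (\<forall>i<m. y $ i = ?q i * y $ m)")
proof
  assume "shifted A (Suc m) *\<^sub>v y = 0\<^sub>v (Suc m)"
  then show "\<forall>i<m. y $ i = ?q i * y $ m"
    using kernel_shifted_Suc_imp[OF assms(1) y] by blast
next
  assume y_eq: "\<forall>i<m. y $ i = ?q i * y $ m"
  obtain v where v: "v \<in> carrier_vec (Suc m)" "v \<noteq> 0\<^sub>v (Suc m)"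
    "shifted A (Suc m) *\<^sub>v v = 0\<^sub>v (Suc m)"
    using assms(2) det_0_iff_vec_prod_zero[OF shifted_carrier] by blast
  have v_eq: "v $ i = ?q i * v $ m" if "i < m" for i
    using kernel_shifted_Suc_imp[OF assms(1) v(1,3) that] .
  have "v $ m \<noteq> 0"
  proof
    assume "v $ m = 0"
    then have "v = 0\<^sub>v (Suc m)"
      using v(1) v_eq by (intro eq_vecI) (auto simp: less_Suc_eq)
    with v(2) show False by contradiction
  qed
  then have "y = (y $ m / v $ m) \<cdot>\<^sub>v v"
    using y v(1) y_eq v_eq by (intro eq_vecI) (auto simp: less_Suc_eq)
  then have "shifted A (Suc m) *\<^sub>v y = (y $ m / v $ m) \<cdot>\<^sub>v (shifted A (Suc m) *\<^sub>v v)"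
    using mult_mat_vec[OF shifted_carrier v(1)] by metis
  then show "shifted A (Suc m) *\<^sub>v y = 0\<^sub>v (Suc m)"
    using v(3) by (intro eq_vecI) auto
qed

definition pad :: "nat \<Rightarrow> real vec \<Rightarrow> ereal vec" where
  "pad n y = vec n (\<lambda>i. if i < dim_vec y then ereal (y $ i) else 0)"

lemma pad_zero: "pad n (0\<^sub>v k) = 0\<^sub>v n"
  by (intro eq_vecI) (auto simp: pad_def zero_ereal_def)

lemma act_pad_index:
  assumes "A \<in> carrier_mat n n" "y \<in> carrier_vec k" "k \<le> n" "i < n"
  shows "act A (pad n y) $ i = ereal (\<Sum>j<k. A $$ (i, j) * y $ j)"
proof -
  have "act A (pad n y) $ i = (\<Sum>j<n. if j < k then ereal (A $$ (i, j) * y $ j) else 0)"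
    using assms by (auto simp: act_def pad_def intro!: sum.cong)
  also have "\<dots> = (\<Sum>j<k. ereal (A $$ (i, j) * y $ j))"
    using assms(3) by (intro sum.mono_neutral_cong_right) auto
  finally show ?thesis by simp
qed

lemma finite_fixed_points_eq:
  assumes A: "A \<in> carrier_mat n n" and "\<exists>i<n. row A i = 0\<^sub>v n" and k: "k \<le> n"
    and rows: "\<forall>i\<in>{k..<n}. row A i = 0\<^sub>v n"
  shows "finite_fixed_points n A =
    pad n ` {y \<in> carrier_vec k. (\<forall>i<k. y $ i \<le> 0) \<and> shifted A k *\<^sub>v y = 0\<^sub>v k}"
    (is "_ = pad n ` ?K")
proof
  have A0: "A $$ (i, j) = 0" if "row A i = 0\<^sub>v n" "i < n" "j < n" for i j
    using A that by (metis carrier_matD index_row(1) index_zero_vec(1))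
  from assms(2) obtain z where z: "z < n" "row A z = 0\<^sub>v n" by blast
  then have n: "n \<ge> 1" by simp
  have fixed_iff: "act A (pad n y) = pad n y \<longleftrightarrow> shifted A k *\<^sub>v y = 0\<^sub>v k"
    if y: "y \<in> carrier_vec k" for y
  proof -
    have "dim_vec (act A (pad n y)) = n" "dim_vec (pad n y) = n"
      using A by (simp_all add: act_def pad_def)
    then have "act A (pad n y) = pad n y \<longleftrightarrow> (\<forall>i<n. act A (pad n y) $ i = pad n y $ i)"
      by (simp only: vec_eq_iff simp_thms)
    also have "\<dots> \<longleftrightarrow> (\<forall>i<n. (\<Sum>j<k. A $$ (i, j) * y $ j) = (if i < k then y $ i else 0))"
      using act_pad_index[OF A y k] y by (auto simp: pad_def zero_ereal_def)
    also have "\<dots> \<longleftrightarrow> (\<forall>i<k. (\<Sum>j<k. A $$ (i, j) * y $ j) = y $ i)"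
    proof -
      have "(\<Sum>j<k. A $$ (i, j) * y $ j) = 0" if "i < n" "\<not> i < k" for i
        using A0[of i] rows that k by (intro sum.neutral) auto
      then show ?thesis using k by auto
    qed
    also have "\<dots> \<longleftrightarrow> shifted A k *\<^sub>v y = 0\<^sub>v k"
    proof -
      have "shifted A k *\<^sub>v y = 0\<^sub>v k \<longleftrightarrow> (\<forall>i<k. (shifted A k *\<^sub>v y) $ i = 0)"
        by (metis carrier_matD(1) dim_mult_mat_vec eq_vecI index_zero_vec shifted_carrier)
      then show ?thesis
        using shifted_mult_vec_index[OF y] by (simp del: index_mult_mat_vec)
    qed
    finally show ?thesis .
  qed
  show "finite_fixed_points n A \<subseteq> pad n ` ?K"
  proof
    fix x assume "x \<in> finite_fixed_points n A"
    then have x: "x \<in> idem n" "act A x = x" "\<forall>i<n. x $ i \<noteq> -\<infinity>"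
      by (auto simp: finite_fixed_points_def fixed_points_def)
    have xn: "x \<in> carrier_vec n" and le: "\<forall>i<n. x $ i \<le> 0"
      using x(1) idem_iff[OF n] by blast+
    have real_x: "ereal (real_of_ereal (x $ i)) = x $ i" if "i < n" for i
      using le x(3) that by (cases "x $ i") auto
    have x0: "x $ i = 0" if "k \<le> i" "i < n" for i
    proof -
      have "act A x $ i = 0"
        using A A0[of i] rows that by (simp add: act_def flip: zero_ereal_def)
      then show ?thesis using x(2) by simp
    qed
    define y where "y = vec k (\<lambda>i. real_of_ereal (x $ i))"
    have y: "y \<in> carrier_vec k" by (simp add: y_def)
    have x_eq: "x = pad n y"
      using xn real_x x0 by (intro eq_vecI) (auto simp: pad_def y_def)
    have "y $ i \<le> 0" if "i < k" for i
      using le k that by (simp add: y_def real_of_ereal_le_0)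
    then show "x \<in> pad n ` ?K"
      using x(2) x_eq fixed_iff[OF y] y by auto
  qed
  show "pad n ` ?K \<subseteq> finite_fixed_points n A"
  proof (rule image_subsetI)
    fix y assume "y \<in> ?K"
    then have y: "y \<in> carrier_vec k" "\<forall>i<k. y $ i \<le> 0" "shifted A k *\<^sub>v y = 0\<^sub>v k"
      by auto
    have fixed: "act A (pad n y) = pad n y"
      using fixed_iff[OF y(1)] y(3) by blast
    have "act A (pad n y) $ z = 0"
      using act_pad_index[OF A y(1) k z(1)] A0[OF z(2,1)] k
      by (simp add: zero_ereal_def)
    then have "pad n y $ z = 0"
      using fixed by simp
    moreover have "pad n y \<in> carrier_vec n" "\<forall>i<n. pad n y $ i \<le> 0"
      using y(1,2) by (auto simp: pad_def)
    ultimately have "pad n y \<in> idem n"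
      using idem_iff[OF n] z(1) by blast
    then show "pad n y \<in> finite_fixed_points n A"
      using fixed by (auto simp: finite_fixed_points_def fixed_points_def pad_def)
  qed
qed

lemma fixed_ray_inj:
  assumes "m < n"
  shows "inj (fixed_ray n A (Suc m))"
proof (rule injI)
  fix \<alpha> \<beta> assume "fixed_ray n A (Suc m) \<alpha> = fixed_ray n A (Suc m) \<beta>"
  then have "fixed_ray n A (Suc m) \<alpha> $ m = fixed_ray n A (Suc m) \<beta> $ m" by simp
  then show "\<alpha> = \<beta>" using assms by (simp add: fixed_ray_def)
qed

lemma fixed_ray_zero: "fixed_ray n A k 0 = 0\<^sub>v n"
  by (intro eq_vecI) (auto simp: fixed_ray_def zero_ereal_def)

lemma not_sign_cond_iff:
  "\<not> sign_cond A (Suc m) \<longleftrightarrow>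
    (\<forall>i<m. det (shifted_repl A (Suc m) i) / det (shifted A m) \<le> 0)"
proof -
  have "a * b > 0 \<longleftrightarrow> \<not> a / b \<le> 0" for a b :: real
    by (simp add: not_le zero_less_mult_iff zero_less_divide_iff)
  then show ?thesis by (simp add: sign_cond_def)
qed

lemma finite_fixed_points_ray:
  assumes "A \<in> carrier_mat n n" "\<exists>i<n. row A i = 0\<^sub>v n" "Suc m \<le> n"
    and "\<forall>i\<in>{Suc m..<n}. row A i = 0\<^sub>v n"
    and "det (shifted A m) \<noteq> 0" "det (shifted A (Suc m)) = 0"
  shows "finite_fixed_points n A =
    fixed_ray n A (Suc m) ` {\<alpha>. \<alpha> \<le> 0 \<and> (\<alpha> = 0 \<or> \<not> sign_cond A (Suc m))}"
    (is "_ = _ ` ?S")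
proof -
  define q where "q i = - (det (shifted_repl A (Suc m) i) / det (shifted A m))" for i
  define r where "r \<alpha> = vec (Suc m) (\<lambda>i. if i < m then q i * \<alpha> else \<alpha>)" for \<alpha>
  have pad_r: "pad n (r \<alpha>) = fixed_ray n A (Suc m) \<alpha>" for \<alpha>
    using assms(3) by (intro eq_vecI) (auto simp: pad_def r_def fixed_ray_def q_def)
  have ker: "shifted A (Suc m) *\<^sub>v y = 0\<^sub>v (Suc m) \<longleftrightarrow> y = r (y $ m)"
    if y: "y \<in> carrier_vec (Suc m)" for y
  proof -
    have "y = r (y $ m) \<longleftrightarrow> (\<forall>i<m. y $ i = q i * y $ m)"
    proof
      assume eq: "y = r (y $ m)"
      show "\<forall>i<m. y $ i = q i * y $ m"
      proof (intro allI impI)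
        fix i assume "i < m"
        have "y $ i = r (y $ m) $ i" by (rule arg_cong[OF eq])
        also have "\<dots> = q i * y $ m" using \<open>i < m\<close> by (simp add: r_def)
        finally show "y $ i = q i * y $ m" .
      qed
    next
      assume "\<forall>i<m. y $ i = q i * y $ m"
      then show "y = r (y $ m)"
        using y by (intro eq_vecI) (auto simp: r_def less_Suc_eq)
    qed
    then show ?thesis
      using kernel_shifted_Suc_iff[OF assms(5,6) y] by (simp add: q_def)
  qed
  have sign: "(\<forall>i<Suc m. r \<alpha> $ i \<le> 0) \<longleftrightarrow> \<alpha> \<in> ?S" for \<alpha>
  proof -
    have "(\<forall>i<Suc m. r \<alpha> $ i \<le> 0) \<longleftrightarrow> \<alpha> \<le> 0 \<and> (\<forall>i<m. q i * \<alpha> \<le> 0)"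
      by (auto simp: r_def less_Suc_eq)
    also have "\<dots> \<longleftrightarrow> \<alpha> \<le> 0 \<and> (\<alpha> = 0 \<or> (\<forall>i<m. 0 \<le> q i))"
      by (auto simp: mult_le_0_iff)
    also have "\<dots> \<longleftrightarrow> \<alpha> \<in> ?S"
      using not_sign_cond_iff[of A m] by (simp add: q_def)
    finally show ?thesis .
  qed
  have "{y \<in> carrier_vec (Suc m). (\<forall>i<Suc m. y $ i \<le> 0) \<and>
      shifted A (Suc m) *\<^sub>v y = 0\<^sub>v (Suc m)} = r ` ?S" (is "?K = _")
  proof
    show "?K \<subseteq> r ` ?S"
    proof
      fix y assume "y \<in> ?K"
      then have "y = r (y $ m)" "\<forall>i<Suc m. y $ i \<le> 0" using ker by blast+
      then show "y \<in> r ` ?S" using sign[of "y $ m"] by (metis image_eqI)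
    qed
    show "r ` ?S \<subseteq> ?K"
    proof (rule image_subsetI)
      fix \<alpha> assume "\<alpha> \<in> ?S"
      moreover have "r \<alpha> \<in> carrier_vec (Suc m)" "r \<alpha> $ m = \<alpha>" by (simp_all add: r_def)
      ultimately show "r \<alpha> \<in> ?K" using sign[of \<alpha>] ker[of "r \<alpha>"] by simp
    qed
  qed
  then show ?thesis
    using finite_fixed_points_eq[OF assms(1-4)] by (simp add: image_image pad_r)
qed

theorem proposition3p2:
  fixes A :: "real mat" and n n\<^sub>0 :: nat
  assumes "A \<in> carrier_mat n n"
    and "\<forall>i<n. \<forall>j<n. A $$ (i, j) \<ge> 0"
    and "\<exists>i<n. row A i = 0\<^sub>v n"
    and "n\<^sub>0 \<in> {1..n}"
    and "\<forall>i\<in>{n\<^sub>0..<n}. row A i = 0\<^sub>v n"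
  shows "(det (shifted A n\<^sub>0) \<noteq> 0 \<longrightarrow> finite_fixed_points n A = {0\<^sub>v n})
    \<and> (det (shifted A n\<^sub>0) = 0 \<and> vec_space.rank n\<^sub>0 (shifted A n\<^sub>0) = n\<^sub>0 - 1
          \<and> det (shifted A (n\<^sub>0 - 1)) \<noteq> 0
        \<longrightarrow> (finite_fixed_points n A = {0\<^sub>v n} \<longleftrightarrow> sign_cond A n\<^sub>0))
    \<and> (det (shifted A n\<^sub>0) = 0 \<and> vec_space.rank n\<^sub>0 (shifted A n\<^sub>0) = n\<^sub>0 - 1
          \<and> det (shifted A (n\<^sub>0 - 1)) \<noteq> 0 \<and> \<not> sign_cond A n\<^sub>0
        \<longrightarrow> infinite (finite_fixed_points n A)
          \<and> finite_fixed_points n A = {fixed_ray n A n\<^sub>0 \<alpha> | \<alpha>. \<alpha> \<le> 0})"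
proof -
  obtain m where m: "n\<^sub>0 = Suc m" "Suc m \<le> n"
    using assms(4) by (cases n\<^sub>0) auto
  have regular: "finite_fixed_points n A = {0\<^sub>v n}" if "det (shifted A n\<^sub>0) \<noteq> 0"
  proof -
    have "y = 0\<^sub>v n\<^sub>0" if "y \<in> carrier_vec n\<^sub>0" "shifted A n\<^sub>0 *\<^sub>v y = 0\<^sub>v n\<^sub>0" for y
      using det_0_iff_vec_prod_zero[OF shifted_carrier] \<open>det (shifted A n\<^sub>0) \<noteq> 0\<close> that by blast
    moreover have "shifted A n\<^sub>0 *\<^sub>v 0\<^sub>v n\<^sub>0 = 0\<^sub>v n\<^sub>0"
      by (intro eq_vecI) (simp_all add: shifted_def)
    ultimately have "{y \<in> carrier_vec n\<^sub>0. (\<forall>i<n\<^sub>0. y $ i \<le> 0) \<and>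
        shifted A n\<^sub>0 *\<^sub>v y = 0\<^sub>v n\<^sub>0} = {0\<^sub>v n\<^sub>0}"
      by auto
    then show ?thesis
      using finite_fixed_points_eq[OF assms(1,3) _ assms(5)] m by (simp add: pad_zero)
  qed
  have inf: "infinite (fixed_ray n A n\<^sub>0 ` {..0})"
    using fixed_ray_inj[of m n A] m infinite_Iic[of "0 :: real"]
    by (metis Suc_le_eq finite_imageD inj_on_subset subset_UNIV)
  have ray: "finite_fixed_points n A =
      (if sign_cond A n\<^sub>0 then {0\<^sub>v n} else fixed_ray n A n\<^sub>0 ` {..0})"
    if "det (shifted A n\<^sub>0) = 0" "det (shifted A (n\<^sub>0 - 1)) \<noteq> 0"
  proof -
    have "{\<alpha> :: real. \<alpha> \<le> 0 \<and> (\<alpha> = 0 \<or> \<not> sign_cond A n\<^sub>0)} =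
        (if sign_cond A n\<^sub>0 then {0} else {..0})"
      by auto
    then show ?thesis
      using finite_fixed_points_ray[of A n m] assms m that by (auto simp: fixed_ray_zero)
  qed
  have "fixed_ray n A n\<^sub>0 ` {..0} \<noteq> {0\<^sub>v n}"
    using inf by (metis finite.emptyI finite.insertI)
  moreover have "{fixed_ray n A n\<^sub>0 \<alpha> | \<alpha>. \<alpha> \<le> 0} = fixed_ray n A n\<^sub>0 ` {..0}"
    by auto
  ultimately show ?thesis
    using regular ray inf by simp
qed

end
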